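(* Let $s\ge 10$ be an integer, let $P=(p_1,\dots,p_n)$ be a probability distribution on $[n]$ with $p_i\le\frac1{2s}$ for all $i$, and let $A=(\alpha_1,\dots,\alpha_n)$ be an arbitrary nonzero real vector. Draw $s$ independent samples from $P$ (type I sampling), let $c_i$ be the number of times element $i$ is selected, and let $W=\sum_{i=1}^n\alpha_i c_i$. Then $$\Pr\big[\,|W-\mathrm E[W]|\ge 2(\ln s)^{3/2}\,\|A\|_2\,\big]\ \le\ \frac1{s^2}.$$
   Context: $[n]=\{1,\dots,n\}$ and $\|A\|_2=(\sum_i\alpha_i^2)^{1/2}$ is the Euclidean norm. *)

theory Defs
  imports "HOL-Probability.Probability"
begin

text \<open>
  Distributions on \<open>[n] = {1..n}\<close> and vectors of length \<open>n\<close> are functions on \<open>nat\<close> that are only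
  consulted on \<open>{1..n}\<close>.
\<close>

definition prob_distribution :: "nat \<Rightarrow> (nat \<Rightarrow> real) \<Rightarrow> bool" where
  "prob_distribution n p \<longleftrightarrow> (\<forall>i\<in>{1..n}. 0 \<le> p i) \<and> (\<Sum>i = 1..n. p i) = 1"

text \<open>
  \<open>X 1, \<dots>, X s\<close> are independent samples (with replacement) from \<open>p\<close>, on an arbitrary probability
  space \<open>M\<close>. Measurability into \<open>count_space {1..n}\<close>, which is part of \<open>indep_vars\<close>, makes the
  samples \<open>{1..n}\<close>-valued on \<open>space M\<close>.
\<close>

definition independent_samples ::
    "'a measure \<Rightarrow> nat \<Rightarrow> (nat \<Rightarrow> real) \<Rightarrow> nat \<Rightarrow> (nat \<Rightarrow> 'a \<Rightarrow> nat) \<Rightarrow> bool" where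
  "independent_samples M n p s X \<longleftrightarrow>
     prob_space M \<and>
     prob_space.indep_vars M (\<lambda>_. count_space {1..n}) X {1..s} \<and>
     (\<forall>j\<in>{1..s}. \<forall>i\<in>{1..n}. \<P>(\<omega> in M. X j \<omega> = i) = p i)"

definition selection_count :: "nat \<Rightarrow> (nat \<Rightarrow> 'a \<Rightarrow> nat) \<Rightarrow> nat \<Rightarrow> 'a \<Rightarrow> nat" where
  "selection_count s X i \<omega> = card {j \<in> {1..s}. X j \<omega> = i}"

definition weighted_count ::
    "nat \<Rightarrow> (nat \<Rightarrow> real) \<Rightarrow> nat \<Rightarrow> (nat \<Rightarrow> 'a \<Rightarrow> nat) \<Rightarrow> 'a \<Rightarrow> real" where
  "weighted_count n \<alpha> s X \<omega> = (\<Sum>i = 1..n. \<alpha> i * real (selection_count s X i \<omega>))"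

end

theory Submission
  imports Defs
begin

text \<open>
  Since \<open>exp x \<le> 1 + x + x\<^sup>2\<close> on \<open>[-1, 1]\<close>, Chernoff's bound with parameter \<open>1\<close> applied to a sum
  \<open>S\<close> of independent variables \<open>Y j\<close> with values in \<open>[-1, 1]\<close> gives
  \<open>Pr[\<bar>S - E S\<bar> \<ge> t] \<le> 2 exp (\<Sum>j. E (Y j)\<^sup>2 - t)\<close>. The variables \<open>Y j = \<alpha> (X j) / \<parallel>A\<parallel>\<^sub>2\<close> sum to
  \<open>W / \<parallel>A\<parallel>\<^sub>2\<close>, and \<open>p i \<le> 1 / (2 s)\<close> makes the sum of their second moments at most \<open>1 / 2\<close>. With
  \<open>t = 2 (ln s)\<^bsup>3/2\<^esup>\<close> the bound is at most \<open>1 / s\<^sup>2\<close> once \<open>ln s \<ge> 2\<close>.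
\<close>

text \<open>For negative \<open>x\<close>, put \<open>y = - x\<close>; the claim becomes
  \<open>1 \<le> (1 - y + y\<^sup>2) * exp y\<close>. Replacing \<open>exp y\<close> by its
  quadratic Taylor lower bound leaves a product in which every negative term cancels.\<close>

lemma exp_le_quadratic:
  fixes x :: real
  assumes "\<bar>x\<bar> \<le> 1"
  shows "exp x \<le> 1 + x + x\<^sup>2"
proof (cases "0 \<le> x")
  case True
  then show ?thesis using assms by (intro exp_bound) auto
next
  case False
  define y where "y = - x"
  have y: "0 \<le> y" using False by (simp add: y_def)
  \<comment> \<open>Complete the square: the expression is
    \<open>(y - 1/2)\<^sup>2 + 3/4\<close>.\<close>
  have pos: "0 < 1 - y + y\<^sup>2"
    using sum_squares_ge_zero[of "y - 1/2" 0] by (simp add: power2_eq_square algebra_simps)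
  have "1 \<le> 1 + y\<^sup>2 / 2 + y^3 / 2 + y^4 / 2"
    using y by simp
  also have "\<dots> = (1 - y + y\<^sup>2) * (1 + y + y\<^sup>2 / 2)"
    by (simp add: field_simps power2_eq_square power3_eq_cube power4_eq_xxxx)
  also have "\<dots> \<le> (1 - y + y\<^sup>2) * exp y"
    using pos y by (intro mult_left_mono exp_lower_Taylor_quadratic) auto
  finally show ?thesis
    by (simp add: y_def exp_minus field_simps)
qed

context prob_space
begin

lemma integrable_abs_le:
  fixes Y :: "'a \<Rightarrow> real"
  assumes "random_variable borel Y" and "\<And>\<omega>. \<omega> \<in> space M \<Longrightarrow> \<bar>Y \<omega>\<bar> \<le> B"
  shows "integrable M Y"
  using assms by (intro integrable_const_bound[of _ B]) auto

text \<open>The quadratic bound is applied to \<open>Y\<close> and the mean is divided out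
  afterwards: \<open>Y\<close> stays in [-1, 1], while the centered variable may leave that
  interval. This is why the raw second moment appears and not the variance.\<close>

lemma expectation_exp_centered_le:
  fixes Y :: "'a \<Rightarrow> real"
  assumes Y [measurable]: "random_variable borel Y"
    and le1: "\<And>\<omega>. \<omega> \<in> space M \<Longrightarrow> \<bar>Y \<omega>\<bar> \<le> 1"
  shows "expectation (\<lambda>\<omega>. exp (Y \<omega> - expectation Y)) \<le> exp (expectation (\<lambda>\<omega>. (Y \<omega>)\<^sup>2))"
proof -
  have int: "integrable M Y"
    using Y le1 by (rule integrable_abs_le)
  have int2: "integrable M (\<lambda>\<omega>. (Y \<omega>)\<^sup>2)"
    using le1 by (intro integrable_abs_le[of _ 1]) (auto simp: abs_square_le_1)
  have inte: "integrable M (\<lambda>\<omega>. exp (Y \<omega>))"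
    using le1 by (intro integrable_abs_le[of _ "exp 1"]) (auto dest: abs_le_D1)
  have "expectation (\<lambda>\<omega>. exp (Y \<omega>)) \<le> expectation (\<lambda>\<omega>. 1 + Y \<omega> + (Y \<omega>)\<^sup>2)"
    using int int2 inte le1 by (intro integral_mono exp_le_quadratic) auto
  also have "\<dots> = 1 + (expectation Y + expectation (\<lambda>\<omega>. (Y \<omega>)\<^sup>2))"
    using int int2 by (simp add: prob_space)
  also have "\<dots> \<le> exp (expectation Y + expectation (\<lambda>\<omega>. (Y \<omega>)\<^sup>2))"
    by (rule exp_ge_add_one_self)
  finally show ?thesis
    by (simp add: exp_diff exp_add field_simps)
qed

text \<open>Markov's inequality for the exponential of the centered sum at level
  \<open>exp t\<close>; by independence its expectation is a product, and each factor is bounded by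
  \<open>expectation_exp_centered_le\<close>.\<close>

lemma sum_upper_tail_le:
  fixes Y :: "'i \<Rightarrow> 'a \<Rightarrow> real"
  assumes fin: "finite I"
    and indep: "indep_vars (\<lambda>_. borel) Y I"
    and le1: "\<And>j \<omega>. j \<in> I \<Longrightarrow> \<omega> \<in> space M \<Longrightarrow> \<bar>Y j \<omega>\<bar> \<le> 1"
  shows "prob {\<omega> \<in> space M. t \<le> (\<Sum>j\<in>I. Y j \<omega> - expectation (Y j))}
    \<le> exp ((\<Sum>j\<in>I. expectation (\<lambda>\<omega>. (Y j \<omega>)\<^sup>2)) - t)"
proof -
  define Z where "Z j \<omega> = exp (Y j \<omega> - expectation (Y j))" for j \<omega>
  have rv: "random_variable borel (Y j)" if "j \<in> I" for j
    using indep that by (auto simp: indep_vars_def)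
  have rvZ: "random_variable borel (Z j)" if "j \<in> I" for j
    using rv[OF that] unfolding Z_def by measurable
  have indepZ: "indep_vars (\<lambda>_. borel) Z I"
    unfolding Z_def by (rule indep_vars_compose2[OF indep]) auto
  have intZ: "integrable M (Z j)" if "j \<in> I" for j
    using le1[OF that] rvZ[OF that]
    by (intro integrable_abs_le[of _ "exp (1 - expectation (Y j))"]) (auto simp: Z_def dest: abs_le_D1)
  have prodZ: "(\<Prod>j\<in>I. Z j \<omega>) = exp (\<Sum>j\<in>I. Y j \<omega> - expectation (Y j))" for \<omega>
    using fin by (simp add: Z_def exp_sum)
  have int: "integrable M (\<lambda>\<omega>. \<Prod>j\<in>I. Z j \<omega>)"
    using fin indepZ intZ by (rule indep_vars_integrable)
  have "{\<omega> \<in> space M. t \<le> (\<Sum>j\<in>I. Y j \<omega> - expectation (Y j))}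
      = {\<omega> \<in> space M. exp t \<le> (\<Prod>j\<in>I. Z j \<omega>)}"
    by (simp add: prodZ)
  then have "prob {\<omega> \<in> space M. t \<le> (\<Sum>j\<in>I. Y j \<omega> - expectation (Y j))}
      \<le> expectation (\<lambda>\<omega>. \<Prod>j\<in>I. Z j \<omega>) / exp t"
    using integral_Markov_inequality_measure[OF int, of "space M" "exp t"] by (simp add: prodZ)
  also have "expectation (\<lambda>\<omega>. \<Prod>j\<in>I. Z j \<omega>) = (\<Prod>j\<in>I. expectation (Z j))"
    using fin indepZ intZ by (rule indep_vars_lebesgue_integral)
  also have "\<dots> \<le> (\<Prod>j\<in>I. exp (expectation (\<lambda>\<omega>. (Y j \<omega>)\<^sup>2)))"
    unfolding Z_def using rv le1 by (intro prod_mono conjI expectation_exp_centered_le) auto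
  also have "\<dots> = exp (\<Sum>j\<in>I. expectation (\<lambda>\<omega>. (Y j \<omega>)\<^sup>2))"
    using fin by (simp add: exp_sum)
  finally show ?thesis
    by (simp add: exp_diff divide_right_mono)
qed

text \<open>Union bound over the upper tails of the sums of \<open>Y j\<close> and of
  \<open>- Y j\<close>, which have the same second moments.\<close>

lemma sum_tail_le:
  fixes Y :: "'i \<Rightarrow> 'a \<Rightarrow> real"
  assumes fin: "finite I"
    and indep: "indep_vars (\<lambda>_. borel) Y I"
    and le1: "\<And>j \<omega>. j \<in> I \<Longrightarrow> \<omega> \<in> space M \<Longrightarrow> \<bar>Y j \<omega>\<bar> \<le> 1"
  shows "prob {\<omega> \<in> space M. t \<le> \<bar>(\<Sum>j\<in>I. Y j \<omega>) - expectation (\<lambda>\<omega>. \<Sum>j\<in>I. Y j \<omega>)\<bar>}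
    \<le> 2 * exp ((\<Sum>j\<in>I. expectation (\<lambda>\<omega>. (Y j \<omega>)\<^sup>2)) - t)"
proof -
  let ?D = "\<lambda>\<omega>. \<Sum>j\<in>I. Y j \<omega> - expectation (Y j)"
  let ?D' = "\<lambda>\<omega>. \<Sum>j\<in>I. - Y j \<omega> - expectation (\<lambda>\<omega>. - Y j \<omega>)"
  have rv: "random_variable borel (Y j)" if "j \<in> I" for j
    using indep that by (auto simp: indep_vars_def)
  have D [measurable]: "?D \<in> borel_measurable M" and D' [measurable]: "?D' \<in> borel_measurable M"
    using rv by auto
  have indep': "indep_vars (\<lambda>_. borel) (\<lambda>j \<omega>. - Y j \<omega>) I"
    by (rule indep_vars_compose2[OF indep]) auto
  have "expectation (\<lambda>\<omega>. \<Sum>j\<in>I. Y j \<omega>) = (\<Sum>j\<in>I. expectation (Y j))"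
    using integrable_abs_le[OF rv le1] by (intro Bochner_Integration.integral_sum) auto
  then have "{\<omega> \<in> space M. t \<le> \<bar>(\<Sum>j\<in>I. Y j \<omega>) - expectation (\<lambda>\<omega>. \<Sum>j\<in>I. Y j \<omega>)\<bar>}
      \<subseteq> {\<omega> \<in> space M. t \<le> ?D \<omega>} \<union> {\<omega> \<in> space M. t \<le> ?D' \<omega>}"
    by (auto simp: sum_subtractf sum_negf abs_if split: if_splits)
  then have "prob {\<omega> \<in> space M. t \<le> \<bar>(\<Sum>j\<in>I. Y j \<omega>) - expectation (\<lambda>\<omega>. \<Sum>j\<in>I. Y j \<omega>)\<bar>}
      \<le> prob ({\<omega> \<in> space M. t \<le> ?D \<omega>} \<union> {\<omega> \<in> space M. t \<le> ?D' \<omega>})"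
    by (intro finite_measure_mono) measurable
  also have "\<dots> \<le> prob {\<omega> \<in> space M. t \<le> ?D \<omega>} + prob {\<omega> \<in> space M. t \<le> ?D' \<omega>}"
    by (intro measure_Un_le) measurable
  also have "prob {\<omega> \<in> space M. t \<le> ?D \<omega>} \<le> exp ((\<Sum>j\<in>I. expectation (\<lambda>\<omega>. (Y j \<omega>)\<^sup>2)) - t)"
    using fin indep le1 by (rule sum_upper_tail_le)
  also have "prob {\<omega> \<in> space M. t \<le> ?D' \<omega>} \<le> exp ((\<Sum>j\<in>I. expectation (\<lambda>\<omega>. (Y j \<omega>)\<^sup>2)) - t)"
    using sum_upper_tail_le[OF fin indep', of t] le1 by simp
  finally show ?thesis by simp
qed

lemma expectation_finite_range:
  fixes f :: "'b \<Rightarrow> real"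
  assumes fin: "finite A" and X: "random_variable (count_space A) X"
  shows "expectation (\<lambda>\<omega>. f (X \<omega>)) = (\<Sum>i\<in>A. prob {\<omega> \<in> space M. X \<omega> = i} * f i)"
proof -
  have meas: "{\<omega> \<in> space M. X \<omega> = i} \<in> events" if "i \<in> A" for i
  proof -
    have "{\<omega> \<in> space M. X \<omega> = i} = X -` {i} \<inter> space M" by auto
    then show ?thesis using measurable_sets[OF X, of "{i}"] that by simp
  qed
  have "expectation (\<lambda>\<omega>. f (X \<omega>))
      = expectation (\<lambda>\<omega>. \<Sum>i\<in>A. indicat_real {\<omega> \<in> space M. X \<omega> = i} \<omega> * f i)"
  proof (rule Bochner_Integration.integral_cong)
    fix \<omega> assume \<omega>: "\<omega> \<in> space M"
    \<comment> \<open>Hence exactly one indicator in the sum is nonzero, the one for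
      \<open>i = X \<omega>\<close>.\<close>
    then have "X \<omega> \<in> A" using measurable_space[OF X] by simp
    then show "f (X \<omega>) = (\<Sum>i\<in>A. indicat_real {\<omega> \<in> space M. X \<omega> = i} \<omega> * f i)"
      using fin \<omega> by (simp add: indicator_def of_bool_def if_distrib[of "\<lambda>x. x * _"] cong: if_cong)
  qed simp
  also have "\<dots> = (\<Sum>i\<in>A. prob {\<omega> \<in> space M. X \<omega> = i} * f i)"
    using meas by (subst Bochner_Integration.integral_sum) (auto simp: emeasure_eq_measure)
  finally show ?thesis .
qed

end

text \<open>Group the samples by their value; since every value lies in \<open>{1..n}\<close>, each
  sample falls in exactly one group. This turns \<open>W\<close> into a sum of independent
  terms.\<close>

lemma weighted_count_eq:
  assumes "\<And>j. j \<in> {1..s} \<Longrightarrow> X j \<omega> \<in> {1..n}"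
  shows "weighted_count n \<alpha> s X \<omega> = (\<Sum>j = 1..s. \<alpha> (X j \<omega>))"
proof -
  have "(\<Sum>j = 1..s. \<alpha> (X j \<omega>)) = (\<Sum>i = 1..n. \<Sum>j | j \<in> {1..s} \<and> X j \<omega> = i. \<alpha> (X j \<omega>))"
    using assms by (intro sum.group[symmetric]) auto
  also have "\<dots> = (\<Sum>i = 1..n. \<alpha> i * real (selection_count s X i \<omega>))"
    by (intro sum.cong) (auto simp: selection_count_def)
  finally show ?thesis by (simp add: weighted_count_def)
qed

text \<open>With \<open>L = ln x\<close> and the factor 2 written as \<open>exp (ln 2)\<close>, the
  claim is \<open>ln 2 + 1/2 + 2 * L \<le> 2 * L powr (3/2)\<close>. From \<open>L \<ge> 2\<close>
  the right side is at least \<open>2.8 * L\<close>, and the surplus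
  \<open>0.8 * L \<ge> 1.6\<close> covers \<open>ln 2 + 1/2 < 1.5\<close>.\<close>

lemma two_exp_le_inverse_square:
  fixes x :: real
  assumes "10 \<le> x"
  shows "2 * exp (1 / 2 - 2 * ln x powr (3 / 2)) \<le> 1 / x\<^sup>2"
proof -
  define L where "L = ln x"
  \<comment> \<open>\<open>exp 2 \<le> 9 < 10 \<le> x\<close> yields
    \<open>ln x \<ge> 2\<close>.\<close>
  have "exp (2 :: real) = exp 1 * exp 1" by (simp flip: exp_add)
  also have "\<dots> \<le> 3 * 3" by (intro mult_mono exp_le) auto
  finally have L: "2 \<le> L" using assms by (simp add: L_def ln_ge_iff)
  have "1.4 \<le> sqrt L" using L by (intro real_le_rsqrt) (simp add: power2_eq_square)
  then have "L * 1.4 \<le> L * sqrt L" using L by (intro mult_left_mono) auto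
  \<comment> \<open>The exponent 3/2 is written as \<open>1 + 1 / 2\<close> so that the power splits
    into \<open>L\<close> and its square root.\<close>
  also have "L * sqrt L = L powr (1 + 1 / 2)"
    using L by (simp only: powr_add) (simp add: powr_half_sqrt)
  finally have "ln 2 + (1 / 2 - 2 * L powr (3 / 2)) \<le> - (2 * L)"
    using L ln_2_less_1 by simp
  then have "exp (ln 2 + (1 / 2 - 2 * L powr (3 / 2))) \<le> exp (- (2 * L))" by simp
  also have "exp (- (2 * L)) = 1 / x\<^sup>2"
    using assms by (simp add: L_def exp_minus exp_double inverse_eq_divide)
  finally show ?thesis by (simp add: exp_add L_def)
qed

theorem lemma6:
  fixes s n :: nat
    and p \<alpha> :: "nat \<Rightarrow> real"
    and M :: "'a measure"
    and X :: "nat \<Rightarrow> 'a \<Rightarrow> nat"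
    and W :: "'a \<Rightarrow> real"
  defines "W \<equiv> weighted_count n \<alpha> s X"
  assumes "s \<ge> 10"
    and "prob_distribution n p"
    and "\<forall>i\<in>{1..n}. p i \<le> 1 / (2 * real s)"
    and "\<exists>i\<in>{1..n}. \<alpha> i \<noteq> 0"
    and "independent_samples M n p s X"
  shows "\<P>(\<omega> in M. \<bar>W \<omega> - prob_space.expectation M W\<bar>
            \<ge> 2 * ln (real s) powr (3 / 2) * L2_set \<alpha> {1..n}) \<le> 1 / (real s)\<^sup>2"
proof -
  have prob_space: "prob_space M"
    and indep: "prob_space.indep_vars M (\<lambda>_. count_space {1..n}) X {1..s}"
    and prob_X: "\<And>j i. j \<in> {1..s} \<Longrightarrow> i \<in> {1..n} \<Longrightarrow> \<P>(\<omega> in M. X j \<omega> = i) = p i"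
    using assms(6) by (auto simp: independent_samples_def)
  interpret prob_space M by (rule prob_space)
  define N where "N = L2_set \<alpha> {1..n}"
  define t where "t = 2 * ln (real s) powr (3 / 2)"
  define Y where "Y j \<omega> = \<alpha> (X j \<omega>) / N" for j \<omega>
  have N: "0 < N"
    using assms(5) by (auto simp: N_def less_le L2_set_eq_0_iff)
  have X: "random_variable (count_space {1..n}) (X j)" if "j \<in> {1..s}" for j
    using indep that unfolding indep_vars_def by blast
  have X_in: "X j \<omega> \<in> {1..n}" if "j \<in> {1..s}" "\<omega> \<in> space M" for j \<omega>
    using measurable_space[OF X[OF that(1)] that(2)] by simp
  have indepY: "indep_vars (\<lambda>_. borel) Y {1..s}"
    unfolding Y_def by (rule indep_vars_compose2[OF indep]) auto
  have Y_le1: "\<bar>Y j \<omega>\<bar> \<le> 1" if "j \<in> {1..s}" "\<omega> \<in> space M" for j \<omega>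
  proof -
    \<comment> \<open>A coordinate is at most the Euclidean norm; passing to absolute values leaves
      the norm unchanged.\<close>
    have "\<bar>\<alpha> (X j \<omega>)\<bar> \<le> L2_set (\<lambda>i. \<bar>\<alpha> i\<bar>) {1..n}"
      using X_in[OF that] by (intro member_le_L2_set) auto
    also have "\<dots> = N" by (simp add: N_def L2_set_def)
    finally show ?thesis using N by (simp add: Y_def)
  qed
  have second_moment: "expectation (\<lambda>\<omega>. (Y j \<omega>)\<^sup>2) \<le> 1 / (2 * real s)" if j: "j \<in> {1..s}" for j
  proof -
    have "expectation (\<lambda>\<omega>. (Y j \<omega>)\<^sup>2) = (\<Sum>i = 1..n. p i * (\<alpha> i / N)\<^sup>2)"
      using expectation_finite_range[OF _ X[OF j], of "\<lambda>i. (\<alpha> i / N)\<^sup>2"] prob_X[OF j]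
      by (simp add: Y_def)
    also have "\<dots> \<le> (\<Sum>i = 1..n. 1 / (2 * real s) * (\<alpha> i / N)\<^sup>2)"
      using assms(4) by (intro sum_mono mult_right_mono) auto
    \<comment> \<open>The normalized squares add up to 1, so only the bound on \<open>p i\<close>
      survives.\<close>
    also have "\<dots> = 1 / (2 * real s) * ((\<Sum>i = 1..n. (\<alpha> i)\<^sup>2) / N\<^sup>2)"
      by (simp add: power_divide sum_distrib_left sum_divide_distrib)
    also have "(\<Sum>i = 1..n. (\<alpha> i)\<^sup>2) = N\<^sup>2"
      by (simp add: N_def L2_set_def sum_nonneg)
    finally show ?thesis using N by simp
  qed
  have moments: "(\<Sum>j = 1..s. expectation (\<lambda>\<omega>. (Y j \<omega>)\<^sup>2)) \<le> 1 / 2"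
    using sum_bounded_above[of "{1..s}", OF second_moment] assms(2) by simp
  have W_eq: "W \<omega> = N * (\<Sum>j = 1..s. Y j \<omega>)" if "\<omega> \<in> space M" for \<omega>
    using weighted_count_eq[of s X \<omega> n \<alpha>, OF X_in] that N
    by (simp add: W_def Y_def flip: sum_divide_distrib)
  \<comment> \<open>The two integrands are known to agree only on \<open>space M\<close>, which is
    enough for the integrals.\<close>
  have EW: "expectation W = N * expectation (\<lambda>\<omega>. \<Sum>j = 1..s. Y j \<omega>)"
    using W_eq by (simp cong: Bochner_Integration.integral_cong)
  have scale: "t * N \<le> \<bar>W \<omega> - expectation W\<bar>
      \<longleftrightarrow> t \<le> \<bar>(\<Sum>j = 1..s. Y j \<omega>) - expectation (\<lambda>\<omega>. \<Sum>j = 1..s. Y j \<omega>)\<bar>" if "\<omega> \<in> space M" for \<omega>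
    using N by (simp add: W_eq[OF that] EW abs_mult mult.commute[of t] flip: right_diff_distrib)
  have "\<P>(\<omega> in M. t * N \<le> \<bar>W \<omega> - expectation W\<bar>)
      = \<P>(\<omega> in M. t \<le> \<bar>(\<Sum>j = 1..s. Y j \<omega>) - expectation (\<lambda>\<omega>. \<Sum>j = 1..s. Y j \<omega>)\<bar>)"
    using scale by (intro arg_cong[of _ _ prob]) auto
  also have "\<dots> \<le> 2 * exp ((\<Sum>j = 1..s. expectation (\<lambda>\<omega>. (Y j \<omega>)\<^sup>2)) - t)"
    using indepY Y_le1 by (intro sum_tail_le) auto
  also have "\<dots> \<le> 2 * exp (1 / 2 - t)"
    using moments by simp
  also have "\<dots> \<le> 1 / (real s)\<^sup>2"
    unfolding t_def using assms(2) by (intro two_exp_le_inverse_square) simp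
  finally show ?thesis by (simp add: t_def N_def)
qed

end
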